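(* Let $\lambda>0$ and $1/3<\alpha<1$. The class $G_{\lambda,\alpha}$ satisfies the following inclusion relations: (i) $G_{\lambda,\alpha}\subset\mathcal{S}^*_{SG}$ whenever $2\lambda e<(e-1)(3\alpha-1)$; (ii) $G_{\lambda,\alpha}\subset\mathcal{S}^*_{e}$ whenever $(2e-1)\lambda<(e-1)(3\alpha-1)$; (iii) $G_{\lambda,\alpha}\subset\mathcal{S}^*_{S}$ whenever $(1+\sin 1)\lambda<(\sin 1)(3\alpha-1)$; (iv) $G_{\lambda,\alpha}\subset\mathcal{S}^*_{L}$ whenever $\sqrt2\,\lambda<(\sqrt2-1)(3\alpha-1)$; (v) $G_{\lambda,\alpha}\subset\mathcal{S}^*_{Ne}$ whenever $5\lambda<2(3\alpha-1)$; (vi) $G_{\lambda,\alpha}\subset\mathcal{S}^*_{C}$ whenever $5\lambda<2(3\alpha-1)$; (vii) $G_{\lambda,\alpha}\subset\mathcal{S}^*_{Cr}$ whenever $(3-\sqrt2)\lambda<(2-\sqrt2)(3\alpha-1)$; (viii) $G_{\lambda,\alpha}\subset\mathcal{S}^*_{\wp}$ whenever $(e+1)\lambda<3\alpha-1$.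
   Context: $\mathbb{D}=\{z\in\mathbb{C}:|z|<1\}$. $\mathcal{A}$ is the class of analytic functions $f$ on $\mathbb{D}$ with $f(0)=0$, $f'(0)=1$. For $0<\alpha\le1$ and $\lambda>0$, $$G_{\lambda,\alpha}=\left\{f\in\mathcal{A}:\left|\frac{1-\alpha+\alpha zf''(z)/f'(z)}{zf'(z)/f(z)}-(1-\alpha)\right|<\lambda,\ z\in\mathbb{D}\right\},$$ where expressions such as $zf'(z)/f(z)$ are given their limiting values at $z=0$. Subordination $p\prec\phi$ means $p=\phi\circ\omega$ for some analytic $\omega:\mathbb{D}\to\mathbb{D}$ with $\omega(0)=0$. $\mathcal{S}^*(\phi)$ is the class of $f\in\mathcal{A}$ with $zf'(z)/f(z)\prec\phi(z)$. The named classes are $\mathcal{S}^*(\phi)$ with: $\phi(z)=2/(1+e^{-z})$ for $\mathcal{S}^*_{SG}$; $\phi(z)=e^z$ for $\mathcal{S}^*_e$; $\phi(z)=1+\sin z$ for $\mathcal{S}^*_S$; $\phi(z)=\sqrt{1+z}$ (principal branch) for $\mathcal{S}^*_L$; $\phi(z)=1+z-z^3/3$ for $\mathcal{S}^*_{Ne}$; $\phi(z)=1+4z/3+2z^2/3$ for $\mathcal{S}^*_C$; $\phi(z)=z+\sqrt{1+z^2}$ (principal branch) for $\mathcal{S}^*_{Cr}$; $\phi(z)=1+ze^z$ for $\mathcal{S}^*_\wp$. *)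

theory Defs
  imports "HOL-Complex_Analysis.Complex_Analysis"
begin

definition unit_disc :: "complex set" (\<open>\<D>\<close>) where
  "\<D> = ball 0 1"

definition class_A :: "(complex \<Rightarrow> complex) set" (\<open>\<A>\<close>) where
  "\<A> = {f. f holomorphic_on \<D> \<and> f 0 = 0 \<and> deriv f 0 = 1}"

text \<open>The quotient \<open>z f'(z) / f(z)\<close>, with its limiting value at the origin;
  see \<open>starlike_quot_tendsto\<close> below.\<close>

definition starlike_quot :: "(complex \<Rightarrow> complex) \<Rightarrow> complex \<Rightarrow> complex" where
  "starlike_quot f z = (if z = 0 then 1 else z * deriv f z / f z)"

lemma starlike_quot_tendsto:
  assumes "f \<in> \<A>"
  shows "((\<lambda>z. z * deriv f z / f z) \<longlongrightarrow> starlike_quot f 0) (at 0)"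
proof -
  have hol: "f holomorphic_on ball 0 1" and f0: "f 0 = 0" and f1: "deriv f 0 = 1"
    using assms by (auto simp: class_A_def unit_disc_def)
  have "(f has_field_derivative 1) (at 0)"
    using holomorphic_derivI[OF hol, of 0] f1 by simp
  hence 1: "((\<lambda>z. f z / z) \<longlongrightarrow> 1) (at 0)"
    by (simp add: has_field_derivative_iff f0)
  have "deriv f holomorphic_on ball 0 1"
    using hol by (intro holomorphic_deriv) auto
  hence "isCont (deriv f) 0"
    by (meson centre_in_ball continuous_on_eq_continuous_at holomorphic_on_imp_continuous_on
        open_ball zero_less_one)
  hence "(deriv f \<longlongrightarrow> 1) (at 0)"
    by (simp add: isCont_def f1)
  from tendsto_divide[OF this 1]
  show ?thesis by (simp add: starlike_quot_def mult.commute)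
qed

text \<open>Division by zero being total in HOL, the nonvanishing conditions below say that the
  quotients in the defining inequality are defined at every point of the disc.\<close>

definition class_G :: "real \<Rightarrow> real \<Rightarrow> (complex \<Rightarrow> complex) set" where
  "class_G lam \<alpha> = {f \<in> \<A>.
     (\<forall>z\<in>\<D>. deriv f z \<noteq> 0) \<and>
     (\<forall>z\<in>\<D> - {0}. f z \<noteq> 0) \<and>
     (\<forall>z\<in>\<D>. norm ((1 - of_real \<alpha> + of_real \<alpha> * z * deriv (deriv f) z / deriv f z)
                     / starlike_quot f z - (1 - of_real \<alpha>)) < lam)}"

definition subordinate :: "(complex \<Rightarrow> complex) \<Rightarrow> (complex \<Rightarrow> complex) \<Rightarrow> bool"
    (infix \<open>\<prec>\<^sub>s\<close> 50) where
  "p \<prec>\<^sub>s \<phi> \<longleftrightarrow> (\<exists>\<omega>. \<omega> holomorphic_on \<D> \<and> \<omega> ` \<D> \<subseteq> \<D> \<and> \<omega> 0 = 0 \<and>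
     (\<forall>z\<in>\<D>. p z = \<phi> (\<omega> z)))"

definition starlike_class :: "(complex \<Rightarrow> complex) \<Rightarrow> (complex \<Rightarrow> complex) set" (\<open>\<S>\<^sup>*\<close>) where
  "\<S>\<^sup>* \<phi> = {f \<in> \<A>. (\<forall>z\<in>\<D> - {0}. f z \<noteq> 0) \<and> starlike_quot f \<prec>\<^sub>s \<phi>}"

definition "starlike_SG = \<S>\<^sup>* (\<lambda>z. 2 / (1 + exp (- z)))"
definition "starlike_e = \<S>\<^sup>* exp"
definition "starlike_S = \<S>\<^sup>* (\<lambda>z. 1 + sin z)"
definition "starlike_L = \<S>\<^sup>* (\<lambda>z. csqrt (1 + z))"
definition "starlike_Ne = \<S>\<^sup>* (\<lambda>z. 1 + z - z ^ 3 / 3)"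
definition "starlike_C = \<S>\<^sup>* (\<lambda>z. 1 + 4 * z / 3 + 2 * z ^ 2 / 3)"
definition "starlike_Cr = \<S>\<^sup>* (\<lambda>z. z + csqrt (1 + z ^ 2))"
definition "starlike_wp = \<S>\<^sup>* (\<lambda>z. 1 + z * exp z)"

end

theory Submission
  imports Defs
begin

text \<open>Let \<open>p = z f'/f\<close> and \<open>h = 1/p - 1\<close>. Differentiating \<open>f = z f' (1 + h)\<close> turns the condition
  defining the class \<open>G\<close> into \<open>\<bar>\<alpha> z h' + (2\<alpha> - 1) h\<bar> < \<lambda>\<close>. By the Schwarz lemma the left-hand
  side is at most \<open>\<lambda> \<bar>z\<bar>\<close>, and integration along rays gives \<open>\<bar>h\<bar> \<le> \<lambda>/(3\<alpha> - 1) \<bar>z\<bar>\<close>. Hence \<open>p\<close>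
  takes its values in a disc of centre 1 and radius \<open>r\<close>, where each \<open>\<lambda>\<close>-condition says
  \<open>\<lambda>/(3\<alpha> - 1) < r/(1 + r)\<close> with \<open>r\<close> the largest radius for which \<open>\<phi>\<close> covers that disc.
  Composing \<open>p\<close> with a holomorphic inverse of \<open>\<phi>\<close> on the disc yields the Schwarz function. The
  inverse is explicit, and bounded by a real majorant, for the classes SG, e, S, L, Cr;
  for Ne, C and wp it comes from the injectivity of \<open>\<phi>\<close> and a lower bound on the unit circle.\<close>

section \<open>Estimates by integration along rays\<close>

text \<open>The curve \<open>f (t * z)\<close> moves no faster than the real function
  \<open>M (t * norm z)\<close>, so the mean value inequality on \<open>{0..1}\<close> compares
  their increments. This serves to bound branches of complex inverse functions by their real
  counterparts.\<close>

lemma norm_le_majorant: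
  fixes f f' :: "complex \<Rightarrow> complex" and M M' :: "real \<Rightarrow> real"
  assumes f: "\<And>z. norm z < r \<Longrightarrow> (f has_field_derivative f' z) (at z)"
    and M: "\<And>x. 0 \<le> x \<Longrightarrow> x < r \<Longrightarrow> (M has_real_derivative M' x) (at x)"
    and le: "\<And>z. norm z < r \<Longrightarrow> norm (f' z) \<le> M' (norm z)"
    and 0: "f 0 = 0" "M 0 = 0" and z: "norm z < r"
  shows "norm (f z) \<le> M (norm z)"
proof -
  have small: "t * norm z < r" if "0 \<le> t" "t \<le> 1" for t
    using that z mult_right_mono[of t 1 "norm z"] by simp
  define g where "g = (\<lambda>t. f (complex_of_real t * z))"
  define N where "N = (\<lambda>t. M (t * norm z))"
  have g: "(g has_vector_derivative z * f' (complex_of_real t * z)) (at t)"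
    if "0 \<le> t" "t \<le> 1" for t
  proof -
    have "((\<lambda>t. complex_of_real t * z) has_vector_derivative z) (at t)"
      by (auto intro!: derivative_eq_intros)
    moreover have "(f has_field_derivative f' (complex_of_real t * z)) (at (complex_of_real t * z))"
      using f small[OF that] that by (simp add: norm_mult)
    ultimately show ?thesis
      unfolding g_def using field_vector_diff_chain_at[of "\<lambda>t. complex_of_real t * z"]
      by (simp add: o_def)
  qed
  have N: "(N has_real_derivative M' (t * norm z) * norm z) (at t)" if "0 \<le> t" "t \<le> 1" for t
    unfolding N_def using M[of "t * norm z"] small[OF that] that
    by (intro DERIV_chain2[of M]) (auto intro!: derivative_eq_intros)
  have "norm (g 1 - g 0) \<le> N 1 - N 0"
  proof (rule differentiable_bound_general)
    show "continuous_on {0..1} g"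
      using g by (intro continuous_at_imp_continuous_on ballI) (auto intro: has_vector_derivative_continuous)
    show "continuous_on {0..1} N"
      using N by (intro continuous_at_imp_continuous_on ballI) (auto intro: DERIV_isCont)
    show "(g has_vector_derivative z * f' (complex_of_real t * z)) (at t)" if "0 < t" "t < 1" for t
      using g that by simp
    show "(N has_vector_derivative M' (t * norm z) * norm z) (at t)" if "0 < t" "t < 1" for t
      using N that by (simp add: has_real_derivative_iff_has_vector_derivative)
    show "norm (z * f' (complex_of_real t * z)) \<le> M' (t * norm z) * norm z"
      if "0 < t" "t < 1" for t
      using le[of "complex_of_real t * z"] small[of t] that
      by (simp add: norm_mult mult.commute mult_left_mono)
  qed auto
  thus ?thesis by (simp add: g_def N_def 0)
qed

text \<open>Writing \<open>h z = z * k z\<close> turns the bounded expression into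
  \<open>z * ((a + c) * k z + a * z * deriv k z)\<close>. The Schwarz lemma cancels the factor
  \<open>z\<close>, and an integrating factor along the ray then bounds \<open>k\<close>. The
  coefficient \<open>c\<close> may be negative as long as \<open>a + c\<close> is positive.\<close>

lemma norm_le_first_order_ode:
  fixes h :: "complex \<Rightarrow> complex" and a c lam :: real
  assumes h: "h holomorphic_on ball 0 1" and h0: "h 0 = 0"
    and a: "a > 0" and ac: "a + c > 0" and lam: "lam > 0"
    and bound: "\<And>z. norm z < 1 \<Longrightarrow> norm (of_real a * z * deriv h z + of_real c * h z) < lam"
    and z: "norm z < 1"
  shows "norm (h z) \<le> lam / (a + c) * norm z"
proof (cases "z = 0")
  case False
  define k where "k = (\<lambda>z. if z = 0 then deriv h 0 else (h z - h 0) / (z - 0))"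
  have k: "k holomorphic_on ball 0 1"
    unfolding k_def by (rule pole_lemma[OF h]) simp
  have hk: "h = (\<lambda>z. z * k z)"
    by (auto simp: k_def h0)
  have dk: "(k has_field_derivative deriv k w) (at w)" if "norm w < 1" for w
    using holomorphic_derivI[OF k open_ball, of w] that by simp
  have dh: "deriv h w = k w + w * deriv k w" if "norm w < 1" for w
    unfolding hk by (rule DERIV_imp_deriv) (auto intro!: derivative_eq_intros dk[OF that])
  define G where "G = (\<lambda>w. of_real a * w * deriv h w + of_real c * h w)"
  have "norm (G w / of_real lam) \<le> norm w" if "norm w < 1" for w
  proof (rule Schwarz_Lemma(1)[OF _ _ _ that])
    show "(\<lambda>w. G w / of_real lam) holomorphic_on ball 0 1"
      unfolding G_def using lam by (intro holomorphic_intros h) auto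
    show "norm (G w / of_real lam) < 1" if "norm w < 1" for w
      using bound[OF that] lam by (simp add: G_def norm_divide)
  qed (simp add: G_def h0)
  hence G: "norm (G w) \<le> lam * norm w" if "norm w < 1" for w
    using that lam by (simp add: norm_divide field_simps)
  have K: "norm (of_real (a + c) * k w + of_real a * w * deriv k w) \<le> lam"
    if "norm w < 1" "w \<noteq> 0" for w
  proof -
    have "G w = w * (of_real (a + c) * k w + of_real a * w * deriv k w)"
      by (simp add: G_def dh[OF that(1)]) (simp add: hk algebra_simps)
    thus ?thesis
      using G[OF that(1)] that(2) by (simp add: norm_mult)
  qed
  \<comment> \<open>The exponent of the integrating factor: since \<open>a * d = a + c\<close>, the
    derivative of \<open>t powr d * k (t * z)\<close> is \<open>t powr (d - 1) / a\<close> times the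
    expression bounded in \<open>K\<close>.\<close>
  define d where "d = (a + c) / a"
  have d: "d > 0" "a * d = a + c"
    using a ac by (auto simp: d_def)
  define g where "g = (\<lambda>t. (t powr d) *\<^sub>R k (complex_of_real t * z))"
  define g' where "g' = (\<lambda>t. (d * t powr (d - 1)) *\<^sub>R k (complex_of_real t * z) +
    (t powr d) *\<^sub>R (z * deriv k (complex_of_real t * z)))"
  have small: "norm (complex_of_real t * z) < 1" if "0 \<le> t" "t \<le> 1" for t
    using that z mult_right_mono[of t 1 "norm z"] by (simp add: norm_mult)
  have dkt: "((\<lambda>t. k (complex_of_real t * z)) has_vector_derivative
      z * deriv k (complex_of_real t * z)) (at t)"
    if "0 \<le> t" "t \<le> 1" for t
  proof -
    have "((\<lambda>t. complex_of_real t * z) has_vector_derivative z) (at t)"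
      by (auto intro!: derivative_eq_intros)
    from field_vector_diff_chain_at[OF this dk[OF small[OF that]]] show ?thesis
      by (simp add: o_def)
  qed
  have dpow: "((\<lambda>t. t powr d) has_real_derivative d * t powr (d - 1)) (at t)" if "0 < t" for t
    using that by (auto intro!: derivative_eq_intros)
  \<comment> \<open>Positivity of \<open>d\<close> gives continuity at 0. Differentiability is
    required on the open interval only, so an exponent below 1 does no harm.\<close>
  have cpow: "continuous_on {0..1} (\<lambda>t. t powr d)"
    using d by (intro continuous_on_powr' continuous_intros) auto
  have "norm (g 1 - g 0) \<le> lam / (a + c) * 1 powr d - lam / (a + c) * 0 powr d"
  proof (rule differentiable_bound_general)
    show "continuous_on {0..1} g"
      unfolding g_def
      by (intro continuous_on_scaleR cpow continuous_at_imp_continuous_on ballI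
          has_vector_derivative_continuous[OF dkt]) auto
    show "continuous_on {0..1} (\<lambda>t. lam / (a + c) * t powr d)"
      by (intro continuous_intros cpow)
    show "(g has_vector_derivative g' t) (at t)" if "0 < t" "t < 1" for t
      unfolding g_def g'_def
      using has_vector_derivative_scaleR[OF dpow[OF that(1)] dkt[of t]] that
      by (simp add: add.commute)
    show "((\<lambda>t. lam / (a + c) * t powr d) has_vector_derivative
        lam / (a + c) * (d * t powr (d - 1))) (at t)"
      if "0 < t" "t < 1" for t
      using DERIV_cmult[OF dpow[OF that(1)], of "lam / (a + c)"]
      by (simp only: has_real_derivative_iff_has_vector_derivative)
    show "norm (g' t) \<le> lam / (a + c) * (d * t powr (d - 1))" if t: "0 < t" "t < 1" for t
    proof -
      let ?w = "complex_of_real t * z"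
      have "t powr d = t powr (d - 1) * t"
        using t powr_add[of t "d - 1" 1] by simp
      hence "g' t = of_real (t powr (d - 1) / a) * (of_real (a * d) * k ?w + of_real a * ?w * deriv k ?w)"
        using a by (simp add: g'_def scaleR_conv_of_real field_simps)
      also have "norm \<dots> \<le> t powr (d - 1) / a * lam"
        using a t False K[of ?w] small[of t] unfolding d(2) norm_mult
        by (intro mult_mono) (auto simp: norm_divide)
      also have "\<dots> = lam / (a + c) * (d * t powr (d - 1))"
        using a ac by (simp add: d_def)
      finally show ?thesis .
    qed
  qed simp
  hence "norm (k z) \<le> lam / (a + c)"
    using d by (simp add: g_def)
  hence "norm z * norm (k z) \<le> norm z * (lam / (a + c))"
    by (rule mult_left_mono) simp
  thus ?thesis
    by (simp add: hk norm_mult mult.commute)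
qed (simp add: h0)

section \<open>From the defining inequality of \<open>class_G\<close> to subordination\<close>

text \<open>In terms of the reciprocal \<open>q\<close> of \<open>starlike_quot f\<close> the
  defining condition becomes linear in \<open>q\<close> and its derivative. The preceding lemma
  applies with \<open>a = \<alpha>\<close> and \<open>c = 2 * \<alpha> - 1\<close>; their sum
  \<open>3 * \<alpha> - 1\<close> is positive exactly when \<open>\<alpha> > 1 / 3\<close>.\<close>

lemma class_G_inverse_quot:
  assumes lam: "lam > 0" and \<alpha>: "1 / 3 < \<alpha>" and f: "f \<in> class_G lam \<alpha>"
  shows "(\<lambda>z. 1 / starlike_quot f z) holomorphic_on \<D>"
    and "z \<in> \<D> \<Longrightarrow> norm (1 / starlike_quot f z - 1) \<le> lam / (3 * \<alpha> - 1) * norm z"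
proof -
  define q where "q = (\<lambda>z. 1 / starlike_quot f z)"
  have hol: "f holomorphic_on ball 0 1" and f0: "f 0 = 0" and f1: "deriv f 0 = 1"
    and d: "\<And>z. norm z < 1 \<Longrightarrow> deriv f z \<noteq> 0"
    and bd: "\<And>z. norm z < 1 \<Longrightarrow> norm ((1 - of_real \<alpha> + of_real \<alpha> * z * deriv (deriv f) z / deriv f z)
                     * q z - (1 - of_real \<alpha>)) < lam"
    using f by (auto simp: class_G_def class_A_def unit_disc_def q_def)
  \<comment> \<open>This is the form in which the singularity at 0 is removable by
    \<open>pole_lemma\<close>; the value there is 1.\<close>
  have q_eq: "q z = (if z = 0 then deriv f 0 else (f z - f 0) / (z - 0)) / deriv f z" for z
    by (simp add: q_def starlike_quot_def f0 f1)
  have holq: "q holomorphic_on ball 0 1"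
    unfolding q_eq by (intro holomorphic_on_divide pole_lemma[OF hol] holomorphic_intros hol)
      (auto simp: d)
  thus "(\<lambda>z. 1 / starlike_quot f z) holomorphic_on \<D>"
    by (simp add: q_def unit_disc_def)
  have fq: "f z = z * deriv f z * q z" if "norm z < 1" for z
    using d[OF that] by (simp add: q_eq f0)
  have dq: "z * deriv q z = 1 - q z - q z * (z * deriv (deriv f) z / deriv f z)"
    if z: "norm z < 1" for z
  proof -
    have q': "(q has_field_derivative deriv q z) (at z)"
      using holomorphic_derivI[OF holq open_ball] z by simp
    have f': "(deriv f has_field_derivative deriv (deriv f) z) (at z)"
      using holomorphic_derivI[OF holomorphic_deriv[OF hol open_ball] open_ball] z by simp
    \<comment> \<open>Both sides of \<open>fq\<close> are differentiated; dividing the result by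
      \<open>deriv f z\<close> isolates \<open>z * deriv q z\<close>.\<close>
    have "((\<lambda>z. z * deriv f z * q z) has_field_derivative
        (deriv f z + z * deriv (deriv f) z) * q z + z * deriv f z * deriv q z) (at z)"
      by (auto intro!: derivative_eq_intros q' f')
    hence "(f has_field_derivative
        (deriv f z + z * deriv (deriv f) z) * q z + z * deriv f z * deriv q z) (at z)"
      by (rule has_field_derivative_transform_within_open[of _ _ _ "ball 0 1"]) (use z fq in auto)
    from DERIV_imp_deriv[OF this] show ?thesis
      using d[OF z] by (simp add: field_simps)
  qed
  show "norm (1 / starlike_quot f z - 1) \<le> lam / (3 * \<alpha> - 1) * norm z" if z: "z \<in> \<D>"
  proof -
    have "norm (q z - 1) \<le> lam / (\<alpha> + (2 * \<alpha> - 1)) * norm z"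
    proof (rule norm_le_first_order_ode)
      fix w :: complex assume w: "norm w < 1"
      have "deriv (\<lambda>z. q z - 1) w = deriv q w"
        using holomorphic_derivI[OF holq open_ball, of w] w
        by (intro DERIV_imp_deriv) (auto intro!: derivative_eq_intros)
      hence "of_real \<alpha> * w * deriv (\<lambda>z. q z - 1) w + of_real (2 * \<alpha> - 1) * (q w - 1)
        = of_real \<alpha> * (w * deriv q w) + of_real (2 * \<alpha> - 1) * (q w - 1)"
        by simp
      \<comment> \<open>Inserting \<open>dq\<close> recovers, up to sign, the expression whose
        modulus is bounded by \<open>lam\<close>.\<close>
      also have "\<dots> = - ((1 - of_real \<alpha> + of_real \<alpha> * w * deriv (deriv f) w / deriv f w)
                     * q w - (1 - of_real \<alpha>))"
        unfolding dq[OF w] by (simp add: algebra_simps)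
      finally show "norm (of_real \<alpha> * w * deriv (\<lambda>z. q z - 1) w + of_real (2 * \<alpha> - 1) * (q w - 1)) < lam"
        using bd[OF w] by (simp only: norm_minus_cancel)
    qed (use lam \<alpha> z holq in \<open>auto intro!: holomorphic_intros simp: unit_disc_def q_def starlike_quot_def\<close>)
    thus ?thesis by (simp add: q_def)
  qed
qed

text \<open>Here \<open>\<psi>\<close> is a right inverse of \<open>\<phi> - 1\<close> on the ball
  of radius \<open>r\<close>. Since \<open>starlike_quot f - 1\<close> takes its values in that
  ball, composing it with \<open>\<psi>\<close> gives the Schwarz function.\<close>

lemma class_G_subset_starlike_class:
  fixes \<psi> \<phi> :: "complex \<Rightarrow> complex"
  assumes lam: "lam > 0" and \<alpha>: "1 / 3 < \<alpha>" and "r > 0"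
    and r: "lam * (1 + r) < r * (3 * \<alpha> - 1)"
    and \<psi>: "\<psi> holomorphic_on ball 0 r" "\<psi> 0 = 0" "\<And>s. norm s < r \<Longrightarrow> norm (\<psi> s) < 1"
    and \<phi>: "\<And>s. norm s < r \<Longrightarrow> \<phi> (\<psi> s) = 1 + s"
  shows "class_G lam \<alpha> \<subseteq> \<S>\<^sup>* \<phi>"
proof
  fix f assume f: "f \<in> class_G lam \<alpha>"
  define q where "q = (\<lambda>z. 1 / starlike_quot f z)"
  have bnd: "norm (q z - 1) * (1 + r) < r" if z: "z \<in> \<D>" for z
  proof -
    have "norm (q z - 1) \<le> lam / (3 * \<alpha> - 1) * norm z"
      unfolding q_def by (rule class_G_inverse_quot(2)[OF lam \<alpha> f z])
    also have "\<dots> \<le> lam / (3 * \<alpha> - 1)"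
      using z lam \<alpha> by (intro mult_left_le) (auto simp: unit_disc_def)
    also have "\<dots> < r / (1 + r)"
      using r \<open>r > 0\<close> \<alpha> by (simp add: field_simps)
    finally show ?thesis
      using \<open>r > 0\<close> by (simp add: field_simps)
  qed
  \<comment> \<open>A zero of \<open>q\<close> would turn \<open>bnd\<close> into
    \<open>1 + r < r\<close>.\<close>
  have nz: "q z \<noteq> 0" if "z \<in> \<D>" for z
    using bnd[OF that] by force
  have quot: "starlike_quot f z = 1 + (1 / q z - 1)" for z
    by (simp add: q_def)
  \<comment> \<open>With \<open>u = norm (q z - 1)\<close>, the bound \<open>bnd\<close> reads
    \<open>u < r * (1 - u)\<close>, and \<open>1 - u \<le> norm (q z)\<close>; dividing by
    \<open>norm (q z)\<close> carries the estimate over to the reciprocal.\<close>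
  have small: "norm (1 / q z - 1) < r" if z: "z \<in> \<D>" for z
  proof -
    have "norm (1 / q z - 1) * norm (q z) = norm (q z - 1)"
      using nz[OF z] by (simp add: norm_mult[symmetric] left_diff_distrib norm_minus_commute)
    also have "\<dots> < r * (1 - norm (q z - 1))"
      using bnd[OF z] by (simp add: algebra_simps)
    also have "\<dots> \<le> r * norm (q z)"
      using norm_triangle_ineq2[of 1 "1 - q z"] \<open>r > 0\<close> by (simp add: norm_minus_commute)
    finally show ?thesis
      using nz[OF z] by simp
  qed
  have "starlike_quot f \<prec>\<^sub>s \<phi>"
    unfolding subordinate_def
  proof (intro exI conjI ballI)
    have "q holomorphic_on \<D>"
      unfolding q_def by (rule class_G_inverse_quot(1)[OF lam \<alpha> f])
    hence "(\<lambda>z. 1 / q z - 1) holomorphic_on \<D>"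
      using nz by (intro holomorphic_intros) auto
    thus "(\<lambda>z. \<psi> (1 / q z - 1)) holomorphic_on \<D>"
      using holomorphic_on_compose_gen[OF _ \<psi>(1), of "\<lambda>z. 1 / q z - 1"] small
      by (force simp: o_def)
    show "starlike_quot f z = \<phi> (\<psi> (1 / q z - 1))" if "z \<in> \<D>" for z
      using \<phi>[OF small[OF that]] quot[of z] by simp
  qed (use \<psi> small in \<open>auto simp: unit_disc_def q_def starlike_quot_def\<close>)
  thus "f \<in> \<S>\<^sup>* \<phi>"
    using f by (auto simp: starlike_class_def class_G_def)
qed

section \<open>Covering a disc by a univalent function\<close>

text \<open>The part of the image inside \<open>ball 0 r\<close> is open by the open mapping theorem and, as the
  boundary circle is mapped outside this ball, also closed in it.\<close>

lemma ball_subset_image_ball: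
  fixes F :: "complex \<Rightarrow> complex"
  assumes F: "F holomorphic_on ball 0 1" "continuous_on (cball 0 1) F" "inj_on F (ball 0 1)"
    and "F 0 = 0" and bd: "\<And>z. norm z = 1 \<Longrightarrow> r \<le> norm (F z)"
  shows "ball 0 r \<subseteq> F ` ball 0 1"
proof (cases "r > 0")
  case True
  let ?I = "F ` ball 0 1 \<inter> ball 0 r"
  have eq: "?I = F ` cball 0 1 \<inter> ball 0 r"
  proof
    show "F ` cball 0 1 \<inter> ball 0 r \<subseteq> ?I"
    proof
      fix w assume "w \<in> F ` cball 0 1 \<inter> ball 0 r"
      then obtain z where z: "norm z \<le> 1" "w = F z" "norm w < r"
        by auto
      hence "norm z \<noteq> 1" using bd[of z] by auto
      thus "w \<in> ?I" using z by auto
    qed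
  qed auto
  have "openin (top_of_set (ball 0 r)) ?I"
    using open_mapping_thm3[OF F(1) _ F(3)] by (simp add: openin_open_Int Int_commute)
  moreover have "closedin (top_of_set (ball 0 r)) ?I"
    unfolding eq using compact_continuous_image[OF F(2) compact_cball]
    by (simp add: closedin_closed_Int Int_commute compact_imp_closed)
  moreover have "0 \<in> ?I"
    using True \<open>F 0 = 0\<close> by (auto intro!: image_eqI[of _ _ 0])
  ultimately have "?I = ball 0 r"
    using connected_clopen[of "ball (0::complex) r"] by blast
  thus ?thesis by blast
qed (simp add: not_less ball_empty)

text \<open>Univalence replaces an explicit formula for the inverse: it yields a holomorphic inverse
  on the whole image, and the lower bound on the unit circle places the ball of radius
  \<open>r\<close> inside that image.\<close>

lemma class_G_subset_starlike_class_univalent: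
  fixes \<phi> :: "complex \<Rightarrow> complex"
  assumes lam: "lam > 0" and \<alpha>: "1 / 3 < \<alpha>" and r: "r > 0"
    "lam * (1 + r) < r * (3 * \<alpha> - 1)"
    and \<phi>: "\<phi> holomorphic_on ball 0 1" "continuous_on (cball 0 1) \<phi>" "inj_on \<phi> (ball 0 1)" "\<phi> 0 = 1"
    and bd: "\<And>z. norm z = 1 \<Longrightarrow> r \<le> norm (\<phi> z - 1)"
  shows "class_G lam \<alpha> \<subseteq> \<S>\<^sup>* \<phi>"
proof -
  define F where "F = (\<lambda>z. \<phi> z - 1)"
  have F: "F holomorphic_on ball 0 1" "inj_on F (ball 0 1)" "F 0 = 0"
    using \<phi> by (auto simp: F_def inj_on_def intro!: holomorphic_intros)
  have sub: "ball 0 r \<subseteq> F ` ball 0 1"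
    by (rule ball_subset_image_ball) (use F \<phi> bd in \<open>auto simp: F_def intro!: continuous_intros\<close>)
  obtain g where g: "g holomorphic_on F ` ball 0 1" "\<And>z. z \<in> ball 0 1 \<Longrightarrow> g (F z) = z"
    using holomorphic_has_inverse[OF F(1) open_ball F(2)] by metis
  show ?thesis
  proof (rule class_G_subset_starlike_class[OF lam \<alpha> r])
    show "g holomorphic_on ball 0 r"
      using g(1) sub by (rule holomorphic_on_subset)
    show "g 0 = 0"
      using g(2)[of 0] F(3) by simp
    fix s :: complex assume "norm s < r"
    then obtain z where "norm z < 1" "s = F z"
      using sub by fastforce
    thus "norm (g s) < 1" "\<phi> (g s) = 1 + s"
      using g(2)[of z] by (auto simp: F_def)
  qed
qed

section \<open>Real majorants for the explicit inverses\<close>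

text \<open>The derivative \<open>1 / (1 + s)\<close> is bounded by \<open>1 / (1 - norm s)\<close>,
  the derivative of the majorant. Equality holds for real \<open>s \<le> 0\<close>.\<close>

lemma norm_Ln_one_plus_le:
  assumes "norm s < 1"
  shows "norm (Ln (1 + s)) \<le> - ln (1 - norm s)"
proof -
  have pos: "Re (1 + s) > 0" if "norm s < 1" for s
    using abs_Re_le_cmod[of s] that by simp
  show ?thesis
  proof (rule norm_le_majorant[where r = 1 and f' = "\<lambda>s. 1 / (1 + s)" and M' = "\<lambda>x. 1 / (1 - x)"])
    show "((\<lambda>s. Ln (1 + s)) has_field_derivative 1 / (1 + z)) (at z)" if "norm z < 1" for z
      using pos[OF that] by (auto intro!: derivative_eq_intros simp: complex_nonpos_Reals_iff field_simps)
    show "norm (1 / (1 + z)) \<le> 1 / (1 - norm z)" if "norm z < 1" for z :: complex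
      using norm_diff_ineq[of 1 z] that by (auto simp: norm_divide intro!: divide_left_mono mult_pos_pos)
  qed (use assms in \<open>auto intro!: derivative_eq_intros\<close>)
qed

text \<open>The numerator times the conjugate of the denominator has real part
  \<open>1 - (norm s)\<^sup>2\<close>. This keeps the Cayley transform of the disc off the branch
  cut of \<open>Ln\<close>.\<close>

lemma Re_Cayley_pos:
  assumes "norm s < 1"
  shows "Re ((1 + s) / (1 - s)) > 0"
proof -
  have "Re ((1 + s) * cnj (1 - s)) = 1 - (norm s)\<^sup>2"
    unfolding cmod_power2 by (simp add: power2_eq_square algebra_simps)
  moreover have "(norm s)\<^sup>2 < 1"
    using assms by (simp add: abs_square_less_1)
  moreover have "norm (1 - s) > 0"
    using assms by auto
  ultimately show ?thesis
    unfolding complex_div_cnj[of "1 + s"] of_real_power[symmetric] Re_divide_of_real by simp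
qed

text \<open>The logarithm is twice the inverse hyperbolic tangent of \<open>s\<close>, with
  derivative \<open>2 / (1 - s\<^sup>2)\<close>; the triangle inequality bounds it by its value at
  \<open>norm s\<close>.\<close>

lemma norm_Ln_Cayley_le:
  assumes "norm s < 1"
  shows "norm (Ln ((1 + s) / (1 - s))) \<le> ln ((1 + norm s) / (1 - norm s))"
proof (rule norm_le_majorant[where r = 1 and f' = "\<lambda>s. 2 / (1 - s\<^sup>2)" and M' = "\<lambda>x. 2 / (1 - x\<^sup>2)"])
  show "((\<lambda>s. Ln ((1 + s) / (1 - s))) has_field_derivative 2 / (1 - z\<^sup>2)) (at z)"
    if "norm z < 1" for z
  proof -
    have "1 - z\<^sup>2 \<noteq> 0" and [simp]: "1 - z \<noteq> 0" "1 + z \<noteq> 0"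
      using that by (auto simp: add_eq_0_iff power2_eq_1_iff)
    moreover from this(1) have "z * z \<noteq> 1"
      by (simp add: power2_eq_square)
    ultimately show ?thesis
      using Re_Cayley_pos[OF that]
      by (auto intro!: derivative_eq_intros simp: complex_nonpos_Reals_iff)
         (simp add: divide_simps, simp add: algebra_simps power2_eq_square)
  qed
  show "((\<lambda>x. ln ((1 + x) / (1 - x))) has_real_derivative 2 / (1 - x\<^sup>2)) (at x)"
    if "0 \<le> x" "x < 1" for x :: real
  proof -
    have "x * x \<noteq> 1" "1 - x\<^sup>2 \<noteq> 0"
      using that by (auto simp: power2_eq_1_iff power2_eq_square[symmetric])
    thus ?thesis
      using that by (auto intro!: derivative_eq_intros)
         (simp add: divide_simps, simp add: algebra_simps power2_eq_square)
  qed
  show "norm (2 / (1 - z\<^sup>2)) \<le> 2 / (1 - (norm z)\<^sup>2)" if "norm z < 1" for z :: complex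
  proof -
    have "1 - (norm z)\<^sup>2 > 0" using that by (simp add: abs_square_less_1)
    thus ?thesis
      using norm_triangle_ineq2[of 1 "z\<^sup>2"]
      by (auto simp: norm_divide norm_power intro!: divide_left_mono mult_pos_pos)
  qed
qed (use assms in auto)

text \<open>The derivative of \<open>Arcsin\<close> has modulus
  \<open>1 / sqrt (norm (1 - z\<^sup>2))\<close>, whichever sign the cosine takes, and
  \<open>norm (1 - z\<^sup>2)\<close> is at least \<open>1 - (norm z)\<^sup>2\<close>.\<close>

lemma norm_Arcsin_le:
  assumes "norm s < 1"
  shows "norm (Arcsin s) \<le> arcsin (norm s)"
proof (rule norm_le_majorant[where r = 1 and f' = "\<lambda>s. inverse (cos (Arcsin s))"
      and M' = "\<lambda>x. inverse (sqrt (1 - x\<^sup>2))"])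
  show "(Arcsin has_field_derivative inverse (cos (Arcsin z))) (at z)" if "norm z < 1" for z
    using that abs_Re_le_cmod[of z] by (intro has_field_derivative_Arcsin) auto
  show "norm (inverse (cos (Arcsin z))) \<le> inverse (sqrt (1 - (norm z)\<^sup>2))"
    if "norm z < 1" for z
  proof -
    have pos: "1 - (norm z)\<^sup>2 > 0" using that by (simp add: abs_square_less_1)
    have "(norm (cos (Arcsin z)))\<^sup>2 = norm (1 - z\<^sup>2)"
      by (simp add: norm_power[symmetric] cos_squared_eq)
    hence "norm (cos (Arcsin z)) = sqrt (norm (1 - z\<^sup>2))"
      by (metis norm_ge_zero real_sqrt_unique)
    moreover have "1 - (norm z)\<^sup>2 \<le> norm (1 - z\<^sup>2)"
      using norm_triangle_ineq2[of 1 "z\<^sup>2"] by (simp add: norm_power)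
    ultimately show ?thesis
      using pos by (auto simp: norm_inverse intro!: le_imp_inverse_le)
  qed
qed (use assms in \<open>auto intro!: DERIV_arcsin\<close>)

section \<open>Univalence of \<open>z * exp z\<close>\<close>

text \<open>In logarithmic coordinates \<open>z = exp a\<close> the claim is that \<open>a + exp a\<close> is injective on the left
  half-plane, where \<open>exp\<close> is a strict contraction.\<close>

lemma inj_on_mult_exp: "inj_on (\<lambda>z::complex. z * exp z) (ball 0 1)"
proof (rule inj_onI)
  fix z w :: complex
  assume z: "z \<in> ball 0 1" and w: "w \<in> ball 0 1" and eq: "z * exp z = w * exp w"
  show "z = w"
  proof (cases "z = 0")
    case True
    thus ?thesis using eq by auto
  next
    case False
    hence "w \<noteq> 0" using eq by auto
    \<comment> \<open>This logarithm of \<open>z\<close> satisfies \<open>a + z = Ln w + w\<close>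
      exactly, whereas \<open>Ln z\<close> might differ from it by a multiple of
      \<open>2 * pi * \<i>\<close>.\<close>
    define a where "a = Ln w + (w - z)"
    have a: "exp a = z"
      using \<open>w \<noteq> 0\<close> eq by (simp add: a_def exp_add exp_diff field_simps)
    have b: "exp (Ln w) = w"
      using \<open>w \<noteq> 0\<close> by simp
    have "exp (Re a) < 1" "exp (Re (Ln w)) < 1"
      using z w a b norm_exp_eq_Re[of a] norm_exp_eq_Re[of "Ln w"] by auto
    hence neg: "Re a < 0" "Re (Ln w) < 0"
      by simp_all
    \<comment> \<open>Both logarithms lie in the half-plane \<open>Re z \<le> m\<close> with
      \<open>m < 0\<close>, where \<open>exp\<close> has Lipschitz constant
      \<open>exp m < 1\<close>.\<close>
    define m where "m = max (Re a) (Re (Ln w))"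
    have "norm (exp a - exp (Ln w)) \<le> exp m * norm (a - Ln w)"
    proof (rule field_differentiable_bound)
      show "convex {z. Re z \<le> m}"
        by (rule convex_halfspace_Re_le)
    qed (auto simp: m_def intro!: derivative_eq_intros)
    hence "norm (z - w) \<le> exp m * norm (z - w)"
      by (simp only: a b) (simp add: a_def norm_minus_commute)
    moreover have "exp m < 1"
      using neg by (simp add: m_def)
    ultimately show ?thesis
      by (smt (verit) mult_less_cancel_right2 norm_le_zero_iff right_minus_eq)
  qed
qed

section \<open>The inclusions, class by class\<close>

lemma class_G_subset_starlike_SG:
  assumes "lam > 0" "1 / 3 < \<alpha>" "2 * lam * exp 1 < (exp 1 - 1) * (3 * \<alpha> - 1)"
  shows "class_G lam \<alpha> \<subseteq> starlike_SG"
proof -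
  \<comment> \<open>The radius at which the majorant reaches 1:
    \<open>(1 + r) / (1 - r) = exp 1\<close>.\<close>
  define r :: real where "r = (exp 1 - 1) / (exp 1 + 1)"
  have pos: "exp 1 + 1 > (0::real)" "exp 1 > (1::real)"
    by (auto intro: add_pos_pos)
  have r: "r > 0" "r < 1"
    using pos less_trans[of "exp 1 - 1" "exp 1" "exp 1 + 1 :: real"]
    by (simp_all only: r_def pos_divide_less_eq zero_less_divide_iff) simp_all
  have r_eq: "1 + r = 2 * exp 1 / (exp 1 + 1)" "1 - r = 2 / (exp 1 + 1)"
    using pos(1) by (simp_all add: r_def add_divide_eq_if_simps diff_divide_eq_iff)
  show ?thesis
    unfolding starlike_SG_def
  proof (rule class_G_subset_starlike_class[OF assms(1,2) r(1), of "\<lambda>s. Ln ((1 + s) / (1 - s))"])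
    show "lam * (1 + r) < r * (3 * \<alpha> - 1)"
      using divide_strict_right_mono[OF assms(3) pos(1)] by (simp add: r_eq(1)) (simp add: r_def mult_ac)
    show "(\<lambda>s. Ln ((1 + s) / (1 - s))) holomorphic_on ball 0 r"
    proof (intro holomorphic_intros)
      show "(1 + s) / (1 - s) \<notin> \<real>\<^sub>\<le>\<^sub>0" if "s \<in> ball 0 r" for s :: complex
        using that r(2) Re_Cayley_pos[of s] by (auto simp: complex_nonpos_Reals_iff)
    qed (use r(2) in auto)
    fix s :: complex assume s: "norm s < r"
    have "(1 + norm s) / (1 - norm s) < (1 + r) / (1 - r)"
      using s r by (intro frac_less) auto
    also have "\<dots> = exp 1"
      using pos(1) by (simp add: r_eq)
    finally have "(1 + norm s) / (1 - norm s) < exp 1" .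
    moreover have "(1 + norm s) / (1 - norm s) > 0"
      using s r by (intro divide_pos_pos add_pos_nonneg) auto
    ultimately have "ln ((1 + norm s) / (1 - norm s)) < 1"
      using ln_less_cancel_iff[of _ "exp (1::real)"] by simp
    thus "norm (Ln ((1 + s) / (1 - s))) < 1"
      using norm_Ln_Cayley_le[of s] s r by linarith
    have "1 - s \<noteq> 0" "1 + s \<noteq> 0"
      using s r by (auto simp: add_eq_0_iff)
    thus "2 / (1 + exp (- Ln ((1 + s) / (1 - s)))) = 1 + s"
      by (simp add: exp_minus field_simps)
  qed simp
qed

lemma class_G_subset_starlike_e:
  assumes "lam > 0" "1 / 3 < \<alpha>" "(2 * exp 1 - 1) * lam < (exp 1 - 1) * (3 * \<alpha> - 1)"
  shows "class_G lam \<alpha> \<subseteq> starlike_e"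
proof -
  \<comment> \<open>The solution of \<open>- ln (1 - r) = 1\<close>.\<close>
  define r :: real where "r = (exp 1 - 1) / exp 1"
  have pos: "exp 1 > (1::real)"
    by simp
  have r: "r > 0" "r < 1"
    using pos by (auto simp: r_def)
  show ?thesis
    unfolding starlike_e_def
  proof (rule class_G_subset_starlike_class[OF assms(1,2) r(1), of "\<lambda>s. Ln (1 + s)"])
    show "lam * (1 + r) < r * (3 * \<alpha> - 1)"
      using divide_strict_right_mono[OF assms(3) exp_gt_zero[of 1]]
      by (simp add: r_def add_divide_distrib diff_divide_distrib algebra_simps)
    have "1 + s \<notin> \<real>\<^sub>\<le>\<^sub>0" if "norm s < r" for s :: complex
      using that r abs_Re_le_cmod[of s] by (auto simp: complex_nonpos_Reals_iff)
    thus "(\<lambda>s. Ln (1 + s)) holomorphic_on ball 0 r"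
      by (intro holomorphic_intros) auto
    fix s :: complex assume s: "norm s < r"
    have "exp (- 1) < 1 - norm s"
      using s by (simp add: r_def exp_minus field_simps)
    hence "- 1 < ln (1 - norm s)"
      using s r by (metis exp_less_cancel_iff exp_ln less_trans exp_gt_zero)
    thus "norm (Ln (1 + s)) < 1"
      using norm_Ln_one_plus_le[of s] s r by linarith
    have "1 + s \<noteq> 0"
      using s r by (auto simp: add_eq_0_iff)
    thus "exp (Ln (1 + s)) = 1 + s"
      by simp
  qed simp
qed

lemma class_G_subset_starlike_S:
  assumes "lam > 0" "1 / 3 < \<alpha>" "(1 + sin 1) * lam < sin 1 * (3 * \<alpha> - 1)"
  shows "class_G lam \<alpha> \<subseteq> starlike_S"
proof -
  \<comment> \<open>This puts 1 in the range of \<open>arcsin\<close>, so the majorant reaches 1 at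
    the radius \<open>sin 1\<close>.\<close>
  have one: "(1::real) < pi / 2"
    using pi_gt3 by simp
  have r: "sin 1 > (0::real)" "sin 1 < (1::real)"
    using sin_gt_zero2[OF _ one] sin_monotone_2pi[of 1 "pi/2"] one by auto
  show ?thesis
    unfolding starlike_S_def
  proof (rule class_G_subset_starlike_class[OF assms(1,2) r(1), of Arcsin])
    show "lam * (1 + sin 1) < sin 1 * (3 * \<alpha> - 1)"
      using assms(3) by (simp add: mult.commute)
    show "Arcsin holomorphic_on ball 0 (sin 1)"
    proof (rule holomorphic_on_Arcsin)
      show "\<bar>Re z\<bar> < 1" if "z \<in> ball 0 (sin 1)" for z
        using that r(2) abs_Re_le_cmod[of z] by simp
    qed
    fix s :: complex assume s: "norm s < sin 1"
    have "arcsin (norm s) < arcsin (sin 1)"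
      using s r by (intro arcsin_less_arcsin) (auto intro: order_trans[of _ 0])
    also have "arcsin (sin 1) = 1"
      using one by (intro arcsin_sin) auto
    finally show "norm (Arcsin s) < 1"
      using norm_Arcsin_le[of s] s r by linarith
  qed auto
qed

text \<open>The inverse is \<open>(1 + s)\<^sup>2 - 1 = s * (2 + s)\<close>, and
  \<open>sqrt 2 - 1\<close> is the positive root of \<open>r * (2 + r) = 1\<close>. Positivity of
  \<open>Re (1 + s)\<close> selects the principal root.\<close>

lemma class_G_subset_starlike_L:
  assumes "lam > 0" "1 / 3 < \<alpha>" "sqrt 2 * lam < (sqrt 2 - 1) * (3 * \<alpha> - 1)"
  shows "class_G lam \<alpha> \<subseteq> starlike_L"
proof -
  have r: "sqrt 2 - 1 > 0" "sqrt 2 - 1 < 1"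
    using real_sqrt_less_mono[of 2 4] by auto
  show ?thesis
    unfolding starlike_L_def
  proof (rule class_G_subset_starlike_class[OF assms(1,2) r(1), of "\<lambda>s. s * (2 + s)"])
    show "lam * (1 + (sqrt 2 - 1)) < (sqrt 2 - 1) * (3 * \<alpha> - 1)"
      using assms(3) by (simp add: mult.commute)
    fix s :: complex assume s: "norm s < sqrt 2 - 1"
    have "norm (s * (2 + s)) \<le> norm s * (2 + norm s)"
      using norm_triangle_ineq[of 2 s] by (auto simp: norm_mult intro!: mult_left_mono)
    also have "\<dots> < (sqrt 2 - 1) * (2 + (sqrt 2 - 1))"
      using s r by (intro mult_strict_mono) auto
    also have "\<dots> = 1"
      by (simp add: algebra_simps)
    finally show "norm (s * (2 + s)) < 1" .
    have "Re (1 + s) > 0"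
      using s r abs_Re_le_cmod[of s] by simp
    hence "csqrt ((1 + s)\<^sup>2) = 1 + s"
      by (intro csqrt_square) auto
    thus "csqrt (1 + s * (2 + s)) = 1 + s"
      by (simp add: power2_eq_square algebra_simps)
  qed (auto intro!: holomorphic_intros)
qed

lemma class_G_subset_starlike_Ne:
  assumes "lam > 0" "1 / 3 < \<alpha>" "5 * lam < 2 * (3 * \<alpha> - 1)"
  shows "class_G lam \<alpha> \<subseteq> starlike_Ne"
  unfolding starlike_Ne_def
proof (rule class_G_subset_starlike_class_univalent[OF assms(1,2), of "2 / 3"])
  show "inj_on (\<lambda>z::complex. 1 + z - z ^ 3 / 3) (ball 0 1)"
  proof (rule inj_onI)
    fix z w :: complex
    assume z: "z \<in> ball 0 1" and w: "w \<in> ball 0 1" and eq: "1 + z - z ^ 3 / 3 = 1 + w - w ^ 3 / 3"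
    \<comment> \<open>The difference of the two values factors, and the second factor cannot vanish
      because each of the three products has modulus below 1.\<close>
    have "(z - w) * (3 - (z * z + z * w + w * w)) = 3 * ((1 + z - z ^ 3 / 3) - (1 + w - w ^ 3 / 3))"
      by (simp add: field_simps power3_eq_cube)
    hence "(z - w) * (3 - (z * z + z * w + w * w)) = 0"
      by (simp add: eq)
    moreover have "norm (z * z + z * w + w * w) < 3"
    proof -
      have "norm (z * z) < 1" "norm (z * w) < 1" "norm (w * w) < 1"
        using z w mult_strict_mono'[of "norm z" 1 "norm w" 1]
          mult_strict_mono'[of "norm z" 1 "norm z" 1] mult_strict_mono'[of "norm w" 1 "norm w" 1]
        by (auto simp: norm_mult)
      thus ?thesis
        using norm_triangle_ineq[of "z * z + z * w" "w * w"] norm_triangle_ineq[of "z * z" "z * w"]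
        by linarith
    qed
    hence "3 - (z * z + z * w + w * w) \<noteq> 0"
      by auto
    ultimately show "z = w" by simp
  qed
  \<comment> \<open>On the unit circle the modulus is at least \<open>1 - 1 / 3\<close>, with
    equality at 1 and -1.\<close>
  show "2 / 3 \<le> norm (1 + z - z ^ 3 / 3 - 1)" if "norm z = 1" for z :: complex
    using norm_triangle_ineq2[of z "z ^ 3 / 3"] that by (simp add: norm_divide norm_power)
qed (use assms(3) in \<open>auto intro!: holomorphic_intros continuous_intros\<close>)

lemma class_G_subset_starlike_C:
  assumes "lam > 0" "1 / 3 < \<alpha>" "5 * lam < 2 * (3 * \<alpha> - 1)"
  shows "class_G lam \<alpha> \<subseteq> starlike_C"
  unfolding starlike_C_def
proof (rule class_G_subset_starlike_class_univalent[OF assms(1,2), of "2 / 3"])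
  show "inj_on (\<lambda>z::complex. 1 + 4 * z / 3 + 2 * z ^ 2 / 3) (ball 0 1)"
  proof (rule inj_onI)
    fix z w :: complex
    assume z: "z \<in> ball 0 1" and w: "w \<in> ball 0 1"
      and eq: "1 + 4 * z / 3 + 2 * z ^ 2 / 3 = 1 + 4 * w / 3 + 2 * w ^ 2 / 3"
    have "(z - w) * (2 + (z + w)) =
        3 / 2 * ((1 + 4 * z / 3 + 2 * z ^ 2 / 3) - (1 + 4 * w / 3 + 2 * w ^ 2 / 3))"
      by (simp add: field_simps power2_eq_square)
    hence "(z - w) * (2 + (z + w)) = 0"
      by (simp add: eq)
    moreover have "2 + (z + w) \<noteq> 0"
    proof
      assume "2 + (z + w) = 0"
      hence "Re (2 + (z + w)) = 0" by simp
      thus False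
        using z w abs_Re_le_cmod[of z] abs_Re_le_cmod[of w] by simp
    qed
    ultimately show "z = w" by simp
  qed
  \<comment> \<open>The bound is \<open>4 / 3 - 2 / 3\<close>, attained at -1.\<close>
  show "2 / 3 \<le> norm (1 + 4 * z / 3 + 2 * z ^ 2 / 3 - 1)" if "norm z = 1" for z :: complex
    using norm_diff_ineq[of "4 * z / 3" "2 * z ^ 2 / 3"] that
    by (simp add: norm_divide norm_mult norm_power)
qed (use assms(3) in \<open>auto intro!: holomorphic_intros continuous_intros\<close>)

text \<open>With \<open>w = 1 + s\<close>, solving \<open>w = z + csqrt (1 + z\<^sup>2)\<close>
  gives \<open>z = (w - 1 / w) / 2\<close>. The radius \<open>2 - sqrt 2\<close> is the solution of
  \<open>r + r / (1 - r) = 2\<close> below 1.\<close>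

lemma class_G_subset_starlike_Cr:
  assumes "lam > 0" "1 / 3 < \<alpha>" "(3 - sqrt 2) * lam < (2 - sqrt 2) * (3 * \<alpha> - 1)"
  shows "class_G lam \<alpha> \<subseteq> starlike_Cr"
proof -
  define r where "r = 2 - sqrt 2"
  have r: "r > 0" "r < 1"
    using real_sqrt_less_mono[of 2 4] by (auto simp: r_def)
  have Re: "Re (1 + s) > 0" if "norm s < r" for s
    using that r abs_Re_le_cmod[of s] by simp
  show ?thesis
    unfolding starlike_Cr_def
  proof (rule class_G_subset_starlike_class[OF assms(1,2) r(1), of "\<lambda>s. (1 + s - 1 / (1 + s)) / 2"])
    show "lam * (1 + r) < r * (3 * \<alpha> - 1)"
      using assms(3) by (simp add: r_def mult.commute)
    show "(\<lambda>s. (1 + s - 1 / (1 + s)) / 2) holomorphic_on ball 0 r"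
    proof -
      have "1 + s \<noteq> 0" if "norm s < r" for s :: complex
        using Re[OF that] by (auto simp: complex_eq_iff)
      thus ?thesis
        by (intro holomorphic_intros) auto
    qed
    fix s :: complex assume s: "norm s < r"
    have nz: "1 + s \<noteq> 0" using Re[OF s] by (auto simp: complex_eq_iff)
    \<comment> \<open>Cancelling the constant term first makes the triangle inequality sharp enough,
      with equality for real \<open>s \<le> 0\<close>.\<close>
    have "1 + s - 1 / (1 + s) = s + s / (1 + s)"
      using nz by (simp add: field_simps)
    hence "norm ((1 + s - 1 / (1 + s)) / 2) = norm (s + s / (1 + s)) / 2"
      by (simp only: norm_divide norm_numeral)
    also have "norm (s + s / (1 + s)) \<le> norm s + norm s / (1 - norm s)"
    proof -
      have "norm s / norm (1 + s) \<le> norm s / (1 - norm s)"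
        using norm_diff_ineq[of 1 s] s r by (intro frac_le) auto
      thus ?thesis
        using norm_triangle_ineq[of s "s / (1 + s)"] by (simp add: norm_divide)
    qed
    also have "\<dots> < r + r / (1 - r)"
      using s r by (intro add_strict_mono frac_less) auto
    also have "\<dots> = 2"
      using r by (simp add: field_simps) (simp add: r_def algebra_simps)
    finally show "norm ((1 + s - 1 / (1 + s)) / 2) < 1"
      by simp
    \<comment> \<open>The candidate for the square root; its positive real part identifies it as the
      principal one.\<close>
    define c where "c = (1 + s + 1 / (1 + s)) / 2"
    have "Re (1 / (1 + s)) > 0"
      using Re[OF s] nz by (simp add: Re_divide sum_power2_gt_zero_iff zero_less_divide_iff)
    hence "Re c > 0"
      using Re[OF s] by (simp add: c_def)
    hence "csqrt (c\<^sup>2) = c"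
      by (intro csqrt_square) auto
    moreover have "1 + ((1 + s - 1 / (1 + s)) / 2)\<^sup>2 = c\<^sup>2"
    proof -
      have "((w + u) / 2)\<^sup>2 = w * u + ((w - u) / 2)\<^sup>2" for w u :: complex
        by (simp add: power2_eq_square field_simps)
      from this[of "1 + s" "1 / (1 + s)"] show ?thesis
        using nz by (simp add: c_def)
    qed
    ultimately have "csqrt (1 + ((1 + s - 1 / (1 + s)) / 2)\<^sup>2) = c"
      by (simp only:)
    thus "(1 + s - 1 / (1 + s)) / 2 + csqrt (1 + ((1 + s - 1 / (1 + s)) / 2)\<^sup>2) = 1 + s"
      by (simp only: c_def) (simp add: field_simps)
  qed simp
qed

lemma class_G_subset_starlike_wp:
  assumes "lam > 0" "1 / 3 < \<alpha>" "(exp 1 + 1) * lam < 3 * \<alpha> - 1"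
  shows "class_G lam \<alpha> \<subseteq> starlike_wp"
  unfolding starlike_wp_def
proof (rule class_G_subset_starlike_class_univalent[OF assms(1,2), of "exp (- 1)"])
  show "lam * (1 + exp (- 1)) < exp (- 1) * (3 * \<alpha> - 1)"
    using divide_strict_right_mono[OF assms(3) exp_gt_zero[of 1]]
    by (simp add: exp_minus inverse_eq_divide add_divide_distrib diff_divide_distrib algebra_simps)
  show "inj_on (\<lambda>z::complex. 1 + z * exp z) (ball 0 1)"
    using inj_on_mult_exp by (simp add: inj_on_def)
  \<comment> \<open>On the unit circle the modulus is \<open>exp (Re z)\<close>, smallest at
    -1.\<close>
  show "exp (- 1) \<le> norm (1 + z * exp z - 1)" if "norm z = 1" for z :: complex
    using abs_Re_le_cmod[of z] that by (simp add: norm_mult)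
qed (auto intro!: holomorphic_intros continuous_intros)

theorem theorem2p11:
  fixes lam \<alpha> :: real
  assumes "lam > 0" and "1 / 3 < \<alpha>" and "\<alpha> < 1"
  shows "(2 * lam * exp 1 < (exp 1 - 1) * (3 * \<alpha> - 1) \<longrightarrow> class_G lam \<alpha> \<subseteq> starlike_SG) \<and>
    ((2 * exp 1 - 1) * lam < (exp 1 - 1) * (3 * \<alpha> - 1) \<longrightarrow> class_G lam \<alpha> \<subseteq> starlike_e) \<and>
    ((1 + sin 1) * lam < sin 1 * (3 * \<alpha> - 1) \<longrightarrow> class_G lam \<alpha> \<subseteq> starlike_S) \<and>
    (sqrt 2 * lam < (sqrt 2 - 1) * (3 * \<alpha> - 1) \<longrightarrow> class_G lam \<alpha> \<subseteq> starlike_L) \<and>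
    (5 * lam < 2 * (3 * \<alpha> - 1) \<longrightarrow> class_G lam \<alpha> \<subseteq> starlike_Ne) \<and>
    (5 * lam < 2 * (3 * \<alpha> - 1) \<longrightarrow> class_G lam \<alpha> \<subseteq> starlike_C) \<and>
    ((3 - sqrt 2) * lam < (2 - sqrt 2) * (3 * \<alpha> - 1) \<longrightarrow> class_G lam \<alpha> \<subseteq> starlike_Cr) \<and>
    ((exp 1 + 1) * lam < 3 * \<alpha> - 1 \<longrightarrow> class_G lam \<alpha> \<subseteq> starlike_wp)"
  using assms class_G_subset_starlike_SG class_G_subset_starlike_e class_G_subset_starlike_S
    class_G_subset_starlike_L class_G_subset_starlike_Ne class_G_subset_starlike_C
    class_G_subset_starlike_Cr class_G_subset_starlike_wp
  by (intro conjI impI) (simp_all only:)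

end
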